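(* Let $S$ be a $(v, e, \lambda_{rr}, -, \lambda_{rc} : r \times c)$ sesqui array on symbols $s_1,\dots,s_v$, and let $m$ be a positive integer. Let $S_1,\dots,S_v$ be pairwise disjoint sets of symbols with $|S_i|=m$ for all $i$. Let $A$ be any $r\times mc$ array obtained from $S$ by replacing each cell of $S$ by a $1\times m$ row of cells, where each cell containing $s_i$ is replaced by a row containing every symbol of $S_i$ exactly once, in an arbitrary order (the order may be different for different occurrences of $s_i$). Then $A$ is an $r\times mc$ sesqui array (on $mv$ symbols) with constant row-row intersection size $m\lambda_{rr}$, constant row-column intersection size $\lambda_{rc}$, and replication number $e$. Moreover, if $m\ge 2$ and $e \geq 2$, then the sesqui array $A$ is proper.
   Context: A row-column design is an $r\times c$ array filled with symbols from a set of $v$ symbols such that no symbol occurs more than once in any row or in any column (binary), and every symbol occurs exactly $e$ times in the array (equireplicate with replication number $e$). Consider the following possible properties, where rows and columns are identified with their symbol sets: (RR) any two distinct rows have exactly $\lambda_{rr}$ common symbols; (CC) any two distinct columns have exactly $\lambda_{cc}$ common symbols (for some constant $\lambda_{cc}$); (RC) any row and any column have exactly $\lambda_{rc}$ common symbols. A $(v, e, \lambda_{rr}, -, \lambda_{rc}: r \times c)$ sesqui array is an $r\times c$ row-column design on $v$ symbols with replication number $e$ satisfying (RR) and (RC). It is proper if (CC) does not hold for any constant. A sesqui array with $v=\max\{r,c\}$ (e.g. a Latin rectangle) is allowed as the input $S$. *)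

theory Defs
  imports Main "HOL-Library.Disjoint_Sets"
begin

text \<open>An \<open>r \<times> c\<close> array is a function \<open>A\<close> of which only the entries \<open>A i j\<close> with
  \<open>i < r\<close> and \<open>j < c\<close> (counting from 0) are relevant.\<close>

definition row_set :: "nat \<Rightarrow> (nat \<Rightarrow> nat \<Rightarrow> 'a) \<Rightarrow> nat \<Rightarrow> 'a set" where
  "row_set c A i = {A i j | j. j < c}"

definition col_set :: "nat \<Rightarrow> (nat \<Rightarrow> nat \<Rightarrow> 'a) \<Rightarrow> nat \<Rightarrow> 'a set" where
  "col_set r A j = {A i j | i. i < r}"

text \<open>Arrays are nonempty: without \<open>r \<ge> 1\<close> and \<open>c \<ge> 1\<close> the empty array on no symbols would be
  a design for every \<open>e\<close>.\<close>

definition row_column_design ::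
  "nat \<Rightarrow> nat \<Rightarrow> nat \<Rightarrow> nat \<Rightarrow> 'a set \<Rightarrow> (nat \<Rightarrow> nat \<Rightarrow> 'a) \<Rightarrow> bool" where
  "row_column_design v e r c V A \<longleftrightarrow>
     r \<ge> 1 \<and> c \<ge> 1 \<and> finite V \<and> card V = v \<and>
     (\<forall>i<r. \<forall>j<c. A i j \<in> V) \<and>
     (\<forall>i<r. inj_on (\<lambda>j. A i j) {..<c}) \<and>
     (\<forall>j<c. inj_on (\<lambda>i. A i j) {..<r}) \<and>
     (\<forall>x\<in>V. card {(i, j). i < r \<and> j < c \<and> A i j = x} = e)"

definition RR :: "nat \<Rightarrow> nat \<Rightarrow> nat \<Rightarrow> (nat \<Rightarrow> nat \<Rightarrow> 'a) \<Rightarrow> bool" where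
  "RR lrr r c A \<longleftrightarrow>
     (\<forall>i<r. \<forall>i'<r. i \<noteq> i' \<longrightarrow> card (row_set c A i \<inter> row_set c A i') = lrr)"

definition CC :: "nat \<Rightarrow> nat \<Rightarrow> nat \<Rightarrow> (nat \<Rightarrow> nat \<Rightarrow> 'a) \<Rightarrow> bool" where
  "CC lcc r c A \<longleftrightarrow>
     (\<forall>j<c. \<forall>j'<c. j \<noteq> j' \<longrightarrow> card (col_set r A j \<inter> col_set r A j') = lcc)"

definition RC :: "nat \<Rightarrow> nat \<Rightarrow> nat \<Rightarrow> (nat \<Rightarrow> nat \<Rightarrow> 'a) \<Rightarrow> bool" where
  "RC lrc r c A \<longleftrightarrow>
     (\<forall>i<r. \<forall>j<c. card (row_set c A i \<inter> col_set r A j) = lrc)"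

text \<open>\<open>sesqui_array v e lrr lrc r c V A\<close>: \<open>A\<close> is a
  \<open>(v, e, lrr, -, lrc : r \<times> c)\<close> sesqui array with symbol set \<open>V\<close>.\<close>

definition sesqui_array ::
  "nat \<Rightarrow> nat \<Rightarrow> nat \<Rightarrow> nat \<Rightarrow> nat \<Rightarrow> nat \<Rightarrow> 'a set \<Rightarrow> (nat \<Rightarrow> nat \<Rightarrow> 'a) \<Rightarrow> bool" where
  "sesqui_array v e lrr lrc r c V A \<longleftrightarrow>
     row_column_design v e r c V A \<and> RR lrr r c A \<and> RC lrc r c A"

definition proper_sesqui_array ::
  "nat \<Rightarrow> nat \<Rightarrow> nat \<Rightarrow> nat \<Rightarrow> nat \<Rightarrow> nat \<Rightarrow> 'a set \<Rightarrow> (nat \<Rightarrow> nat \<Rightarrow> 'a) \<Rightarrow> bool" where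
  "proper_sesqui_array v e lrr lrc r c V A \<longleftrightarrow>
     sesqui_array v e lrr lrc r c V A \<and> \<not> (\<exists>lcc. CC lcc r c A)"

text \<open>Cell \<open>(i, j)\<close> of \<open>S\<close> becomes the cells \<open>(i, j * m), \<dots>, (i, j * m + (m - 1))\<close> of \<open>A\<close>.
  The bijection is an ordering of \<open>T k\<close>, chosen separately for each cell.\<close>

definition cellwise_replacement ::
  "nat \<Rightarrow> nat \<Rightarrow> nat \<Rightarrow> nat \<Rightarrow> (nat \<Rightarrow> 'a) \<Rightarrow> (nat \<Rightarrow> 'b set) \<Rightarrow>
   (nat \<Rightarrow> nat \<Rightarrow> 'a) \<Rightarrow> (nat \<Rightarrow> nat \<Rightarrow> 'b) \<Rightarrow> bool" where
  "cellwise_replacement m r c v s T S A \<longleftrightarrow>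
     (\<forall>i<r. \<forall>j<c. \<forall>k\<in>{1..v}. S i j = s k \<longrightarrow>
        bij_betw (\<lambda>t. A i (j * m + t)) {..<m} (T k))"

end

theory Submission
  imports Defs
begin

text \<open>Sending every symbol of \<open>S\<^sub>i\<close> back to \<open>s\<^sub>i\<close> is an \<open>m\<close>-to-one projection
  under which the array \<open>A\<close> lies over \<open>S\<close>. A row of \<open>A\<close> is the full preimage of the row of \<open>S\<close>
  below it, a column of \<open>A\<close> is mapped bijectively onto the column of \<open>S\<close> below it, and the
  occurrences of a symbol correspond to those of its projection; this gives all the parameters.
  Two columns of \<open>A\<close> over the same column of \<open>S\<close> are disjoint, whereas a symbol occurring twice
  lies in two columns, so for \<open>m \<ge> 2\<close> and \<open>e \<ge> 2\<close> property (CC) fails.\<close>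

text \<open>Fibres are indexed by the symbols of \<open>S\<close> themselves instead of by an
  enumeration. The projection \<open>p\<close> encodes their disjointness: no \<open>x\<close> can
  lie over two symbols, because \<open>p x\<close> recovers the symbol.\<close>

locale blown_up_array =
  fixes m r c :: nat and V :: "'a set" and F :: "'a \<Rightarrow> 'b set" and p :: "'b \<Rightarrow> 'a"
    and S :: "nat \<Rightarrow> nat \<Rightarrow> 'a" and A :: "nat \<Rightarrow> nat \<Rightarrow> 'b"
  assumes m_pos: "m > 0"
    and entry: "\<lbrakk>i < r; j < c\<rbrakk> \<Longrightarrow> S i j \<in> V"
    and fibre: "\<lbrakk>a \<in> V; x \<in> F a\<rbrakk> \<Longrightarrow> p x = a"
    and finite_fibre: "a \<in> V \<Longrightarrow> finite (F a)"
    and card_fibre: "a \<in> V \<Longrightarrow> card (F a) = m"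
    and cell: "\<lbrakk>i < r; j < c\<rbrakk> \<Longrightarrow> bij_betw (\<lambda>t. A i (j * m + t)) {..<m} (F (S i j))"
begin

section \<open>Cells, fibres and the projection\<close>

lemma div_lt: "j < m * c \<Longrightarrow> j div m < c"
  using m_pos by (simp add: less_mult_imp_div_less mult.commute)

lemma index_lt: "\<lbrakk>j < c; t < m\<rbrakk> \<Longrightarrow> j * m + t < m * c"
  using mult_le_mono1[of "Suc j" c m] by (simp add: mult.commute)

lemma entry_in_fibre:
  assumes "i < r" "j < m * c"
  shows "A i j \<in> F (S i (j div m))"
  using bij_betwE[OF cell[OF assms(1) div_lt[OF assms(2)]]] m_pos
  by (metis div_mult_mod_eq lessThan_iff mod_less_divisor)

lemma proj_entry: "\<lbrakk>i < r; j < m * c\<rbrakk> \<Longrightarrow> p (A i j) = S i (j div m)"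
  using entry_in_fibre entry fibre div_lt by blast

lemma fibre_entryE:
  assumes "i < r" "j < c" "x \<in> F (S i j)"
  obtains j' where "j' < m * c" "j' div m = j" "A i j' = x"
proof -
  have "x \<in> (\<lambda>t. A i (j * m + t)) ` {..<m}"
    using cell[OF assms(1,2)] assms(3) by (simp add: bij_betw_def)
  then obtain t where t: "t < m" "A i (j * m + t) = x"
    by auto
  show ?thesis
    using that[of "j * m + t"] t index_lt[OF assms(2)] by simp
qed

text \<open>Columns of one block differ only in their residue modulo \<open>m\<close>, and the
  ordering of the cell is injective in that residue.\<close>

lemma entry_inj_in_cell:
  assumes "i < r" "j < m * c" "j' < m * c" "j div m = j' div m" "A i j = A i j'"
  shows "j = j'"
proof -
  have "inj_on (\<lambda>t. A i (j div m * m + t)) {..<m}"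
    using cell[OF assms(1) div_lt[OF assms(2)]] by (rule bij_betw_imp_inj_on)
  moreover have "A i (j div m * m + j mod m) = A i (j div m * m + j' mod m)"
    using assms(4,5) div_mult_mod_eq[of j m] div_mult_mod_eq[of j' m] by simp
  ultimately have "j mod m = j' mod m"
    by (rule inj_onD) (use m_pos in auto)
  then show ?thesis
    using assms(4) by (metis div_mult_mod_eq)
qed

section \<open>Rows and intersection sizes\<close>

lemma row_subset: "i < r \<Longrightarrow> row_set c S i \<subseteq> V"
  using entry by (auto simp: row_set_def)

lemma row_set_eq:
  assumes "i < r"
  shows "row_set (m * c) A i = (\<Union>a\<in>row_set c S i. F a)"
proof (intro equalityI subsetI)
  fix x assume "x \<in> row_set (m * c) A i"
  then obtain j where "j < m * c" "x = A i j"
    by (auto simp: row_set_def)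
  then show "x \<in> (\<Union>a\<in>row_set c S i. F a)"
    using entry_in_fibre[OF assms] div_lt by (auto simp: row_set_def)
next
  fix x assume "x \<in> (\<Union>a\<in>row_set c S i. F a)"
  then obtain j where "j < c" "x \<in> F (S i j)"
    by (auto simp: row_set_def)
  then show "x \<in> row_set (m * c) A i"
    by (rule fibre_entryE[OF assms]) (auto simp: row_set_def)
qed

lemma card_fibre_union:
  assumes "W \<subseteq> V" "finite W"
  shows "card (\<Union>a\<in>W. F a) = m * card W"
proof -
  have "card (\<Union>a\<in>W. F a) = (\<Sum>a\<in>W. card (F a))"
    using assms finite_fibre fibre by (intro card_UN_disjoint) blast+
  also have "\<dots> = (\<Sum>a\<in>W. m)"
    using assms card_fibre by (intro sum.cong) auto
  finally show ?thesis by simp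
qed

text \<open>As fibres over different symbols are disjoint, intersecting two unions of fibres leaves
  the fibres over the common symbols, each of size \<open>m\<close>.\<close>

lemma RR_blow_up:
  assumes "RR l r c S"
  shows "RR (m * l) r (m * c) A"
  unfolding RR_def
proof (intro allI impI)
  fix i i' assume i: "i < r" "i' < r" "i \<noteq> i'"
  have "row_set (m * c) A i \<inter> row_set (m * c) A i' = (\<Union>a\<in>row_set c S i \<inter> row_set c S i'. F a)"
    unfolding row_set_eq[OF i(1)] row_set_eq[OF i(2)]
    using row_subset[OF i(1)] row_subset[OF i(2)] by (auto dest: fibre)
  moreover have "finite (row_set c S i \<inter> row_set c S i')"
    by (simp add: row_set_def)
  ultimately show "card (row_set (m * c) A i \<inter> row_set (m * c) A i') = m * l"
    using card_fibre_union row_subset[OF i(1)] assms i by (simp add: RR_def le_infI1)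
qed

text \<open>A column takes just one symbol from each fibre it meets, so the factor \<open>m\<close>
  disappears: \<open>p\<close> restricts to a bijection between the two intersections.\<close>

lemma RC_blow_up:
  assumes RC: "RC l r c S"
    and inj: "\<And>j. j < c \<Longrightarrow> inj_on (\<lambda>i. S i j) {..<r}"
  shows "RC l r (m * c) A"
  unfolding RC_def
proof (intro allI impI)
  fix i j assume ij: "i < r" "j < m * c"
  define X where "X = row_set (m * c) A i \<inter> col_set r A j"
  \<comment> \<open>The projections of the entries of column \<open>j\<close> are the entries of
    column \<open>j div m\<close> of \<open>S\<close>, which are distinct.\<close>
  have "inj_on p (col_set r A j)"
    using inj[OF div_lt[OF ij(2)]] ij(2)
    by (auto simp: col_set_def proj_entry intro!: inj_onI dest: inj_onD)
  then have "inj_on p X"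
    by (rule inj_on_subset) (simp add: X_def)
  moreover have "p ` X = row_set c S i \<inter> col_set r S (j div m)"
  proof (intro equalityI subsetI)
    fix a assume "a \<in> p ` X"
    then obtain x where x: "a = p x" "x \<in> row_set (m * c) A i" "x \<in> col_set r A j"
      by (auto simp: X_def)
    have "a \<in> row_set c S i"
      using x(1,2) proj_entry ij(1) div_lt by (auto simp: row_set_def)
    moreover have "a \<in> col_set r S (j div m)"
      using x(1,3) proj_entry ij(2) by (auto simp: col_set_def)
    ultimately show "a \<in> row_set c S i \<inter> col_set r S (j div m)"
      by simp
  next
    fix a assume a: "a \<in> row_set c S i \<inter> col_set r S (j div m)"
    then obtain i' where i': "i' < r" "a = S i' (j div m)"
      by (auto simp: col_set_def)
    \<comment> \<open>The entry of column \<open>j\<close> over \<open>a\<close> is the required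
      preimage: row \<open>i\<close> contains the whole fibre over \<open>a\<close>, in whatever
      order.\<close>
    then have "A i' j \<in> X"
      using a entry_in_fibre[OF i'(1) ij(2)] row_set_eq[OF ij(1)]
      by (auto simp: X_def col_set_def)
    then show "a \<in> p ` X"
      using proj_entry[OF i'(1) ij(2)] i'(2) by force
  qed
  ultimately have "card X = card (row_set c S i \<inter> col_set r S (j div m))"
    by (metis card_image)
  then show "card (row_set (m * c) A i \<inter> col_set r A j) = l"
    using RC ij div_lt by (simp add: X_def RC_def)
qed

section \<open>Replication and the design property\<close>

text \<open>Forgetting the position inside the cell is a bijection on occurrences: a cell over
  \<open>a\<close> contains \<open>x\<close> exactly once, and no other cell contains it.\<close>

lemma replication_blow_up:
  assumes "a \<in> V" "x \<in> F a"
  shows "card {(i, j). i < r \<and> j < m * c \<and> A i j = x} = card {(i, j). i < r \<and> j < c \<and> S i j = a}"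
proof (rule bij_betw_same_card)
  let ?f = "\<lambda>(i, j). (i, j div m)"
  show "bij_betw ?f {(i, j). i < r \<and> j < m * c \<and> A i j = x} {(i, j). i < r \<and> j < c \<and> S i j = a}"
    unfolding bij_betw_def
  proof (intro conjI equalityI subsetI)
    show "inj_on ?f {(i, j). i < r \<and> j < m * c \<and> A i j = x}"
      by (auto simp: inj_on_def intro: entry_inj_in_cell)
  next
    fix z assume "z \<in> ?f ` {(i, j). i < r \<and> j < m * c \<and> A i j = x}"
    then show "z \<in> {(i, j). i < r \<and> j < c \<and> S i j = a}"
      using div_lt fibre[OF assms] by (auto simp: proj_entry[symmetric])
  next
    fix z assume "z \<in> {(i, j). i < r \<and> j < c \<and> S i j = a}"
    then obtain i j where z: "z = (i, j)" "i < r" "j < c" "x \<in> F (S i j)"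
      using assms(2) by auto
    then obtain j' where "j' < m * c" "j' div m = j" "A i j' = x"
      using fibre_entryE by metis
    then show "z \<in> ?f ` {(i, j). i < r \<and> j < m * c \<and> A i j = x}"
      using z by force
  qed
qed

lemma row_column_design_blow_up:
  assumes "row_column_design v e r c V S"
  shows "row_column_design (m * v) e r (m * c) (\<Union>a\<in>V. F a) A"
  unfolding row_column_design_def
proof (intro conjI allI impI ballI)
  note D = assms[unfolded row_column_design_def]
  show "r \<ge> 1" "m * c \<ge> 1"
    using D m_pos by auto
  show "finite (\<Union>a\<in>V. F a)" "card (\<Union>a\<in>V. F a) = m * v"
    using D finite_fibre card_fibre_union[of V] by auto
  show "A i j \<in> (\<Union>a\<in>V. F a)" if "i < r" "j < m * c" for i j
    using entry_in_fibre entry div_lt that by blast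
  show "inj_on (\<lambda>j. A i j) {..<m * c}" if i: "i < r" for i
  proof (rule inj_onI, unfold lessThan_iff)
    fix j j' assume j: "j < m * c" "j' < m * c" "A i j = A i j'"
    \<comment> \<open>Equal entries have equal projections; distinctness in the row of
      \<open>S\<close> then puts both in one cell.\<close>
    then have "S i (j div m) = S i (j' div m)"
      using proj_entry[OF i] by metis
    then have "j div m = j' div m"
      using D i j(1,2) div_lt by (auto dest!: inj_onD)
    then show "j = j'"
      using entry_inj_in_cell i j by blast
  qed
  show "inj_on (\<lambda>i. A i j) {..<r}" if j: "j < m * c" for j
  proof (rule inj_onI, unfold lessThan_iff)
    fix i i' assume i: "i < r" "i' < r" "A i j = A i' j"
    then have "S i (j div m) = S i' (j div m)"
      using proj_entry j by metis
    then show "i = i'"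
      using D i(1,2) div_lt[OF j] by (auto dest!: inj_onD)
  qed
  show "card {(i, j). i < r \<and> j < m * c \<and> A i j = x} = e" if "x \<in> (\<Union>a\<in>V. F a)" for x
    using that replication_blow_up D by auto
qed

lemma sesqui_array_blow_up:
  assumes "sesqui_array v e lrr lrc r c V S"
  shows "sesqui_array (m * v) e (m * lrr) lrc r (m * c) (\<Union>a\<in>V. F a) A"
proof -
  have "row_column_design v e r c V S" "RR lrr r c S" "RC lrc r c S"
    using assms by (simp_all add: sesqui_array_def)
  moreover from this(1) have "inj_on (\<lambda>i. S i j) {..<r}" if "j < c" for j
    using that by (simp add: row_column_design_def)
  ultimately show ?thesis
    by (simp add: sesqui_array_def row_column_design_blow_up RR_blow_up RC_blow_up)
qed

section \<open>Failure of (CC)\<close>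

text \<open>A common symbol would project to one symbol of the underlying column of
  \<open>S\<close>, forcing equal rows; then a single cell would contain it twice.\<close>

lemma col_sets_disjoint:
  assumes inj: "inj_on (\<lambda>i. S i (j div m)) {..<r}"
    and j: "j < m * c" "j' < m * c" "j div m = j' div m" "j \<noteq> j'"
  shows "col_set r A j \<inter> col_set r A j' = {}"
proof (rule ccontr)
  assume "col_set r A j \<inter> col_set r A j' \<noteq> {}"
  then obtain i i' where i: "i < r" "i' < r" "A i j = A i' j'"
    by (auto simp: col_set_def)
  then have "S i (j div m) = S i' (j div m)"
    using proj_entry j by metis
  then have "i = i'"
    using inj i(1,2) by (auto dest: inj_onD)
  then show False
    using entry_inj_in_cell i j by blast
qed

end

lemma replicated_symbol_cols_meet:
  assumes design: "row_column_design v e r c V A" and "e \<ge> 2"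
  obtains j j' where "j < c" "j' < c" "j \<noteq> j'" "col_set r A j \<inter> col_set r A j' \<noteq> {}"
proof -
  note D = design[unfolded row_column_design_def]
  \<comment> \<open>The array is nonempty, so this entry is a genuine symbol and occurs
    \<open>e\<close> times.\<close>
  define x where "x = A 0 0"
  define X where "X = {(i, j). i < r \<and> j < c \<and> A i j = x}"
  have "card X = e"
    using D by (auto simp: X_def x_def)
  then have "\<not> card X \<le> Suc 0" "finite X"
    using \<open>e \<ge> 2\<close> by (auto intro: card_ge_0_finite)
  then obtain y z where "y \<in> X" "z \<in> X" "y \<noteq> z"
    using card_le_Suc0_iff_eq by blast
  then obtain i j i' j' where *: "i < r" "j < c" "A i j = x" "i' < r" "j' < c" "A i' j' = x"
    "(i, j) \<noteq> (i', j')"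
    by (auto simp: X_def)
  \<comment> \<open>Two occurrences in one column would have to be in the same row, hence be the
    same cell.\<close>
  have "j \<noteq> j'"
    using * D by (auto dest!: inj_onD)
  moreover have "A i j \<in> col_set r A j" "A i' j' \<in> col_set r A j'"
    using *(1,4) by (auto simp: col_set_def)
  then have "x \<in> col_set r A j \<inter> col_set r A j'"
    using *(3,6) by simp
  ultimately show ?thesis
    using that * by blast
qed

lemma (in blown_up_array) not_CC_blow_up:
  assumes design: "row_column_design v e r c V S" and "m \<ge> 2" "e \<ge> 2"
  shows "\<not> CC l r (m * c) A"
proof
  assume CC: "CC l r (m * c) A"
  have c: "c > 0" and inj: "inj_on (\<lambda>i. S i 0) {..<r}"
    using design by (auto simp: row_column_design_def)
  then have lt: "1 < m * c"
    using \<open>m \<ge> 2\<close> c mult_le_mono[of 2 m 1 c] by simp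
  \<comment> \<open>For \<open>m \<ge> 2\<close> columns 0 and 1 both lie over column 0 of
    \<open>S\<close>, so the constant in (CC) can only be 0.\<close>
  have "col_set r A 0 \<inter> col_set r A 1 = {}"
    using col_sets_disjoint[of 0 1] inj lt c \<open>m \<ge> 2\<close> by simp
  moreover have "card (col_set r A 0 \<inter> col_set r A 1) = l"
    using CC lt unfolding CC_def
    by (metis gr_implies_not0 neq0_conv zero_neq_one)
  ultimately have "l = 0"
    by simp
  obtain j j' where j: "j < m * c" "j' < m * c" "j \<noteq> j'"
    and "col_set r A j \<inter> col_set r A j' \<noteq> {}"
    using replicated_symbol_cols_meet[OF row_column_design_blow_up[OF design] \<open>e \<ge> 2\<close>] by metis
  moreover have "finite (col_set r A j \<inter> col_set r A j')"
    by (simp add: col_set_def)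
  ultimately have "card (col_set r A j \<inter> col_set r A j') \<noteq> 0"
    by simp
  then show False
    using CC j \<open>l = 0\<close> by (simp add: CC_def)
qed

theorem theorem4p2:
  fixes v e lrr lrc r c m :: nat
    and V :: "'a set" and s :: "nat \<Rightarrow> 'a" and T :: "nat \<Rightarrow> 'b set"
    and S :: "nat \<Rightarrow> nat \<Rightarrow> 'a" and A :: "nat \<Rightarrow> nat \<Rightarrow> 'b"
  assumes "sesqui_array v e lrr lrc r c V S"
    and "bij_betw s {1..v} V"
    and "m \<ge> 1"
    and "disjoint_family_on T {1..v}"
    and "\<forall>k\<in>{1..v}. finite (T k) \<and> card (T k) = m"
    and "cellwise_replacement m r c v s T S A"
  shows "sesqui_array (m * v) e (m * lrr) lrc r (m * c) (\<Union>k\<in>{1..v}. T k) A \<and>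
    (m \<ge> 2 \<and> e \<ge> 2 \<longrightarrow>
      proper_sesqui_array (m * v) e (m * lrr) lrc r (m * c) (\<Union>k\<in>{1..v}. T k) A)"
proof -
  define g where "g = the_inv_into {1..v} s"
  \<comment> \<open>Disjointness of the \<open>T k\<close> makes the described index unique on their
    union, where all entries of the array lie.\<close>
  define p where "p x = s (THE k. k \<in> {1..v} \<and> x \<in> T k)" for x
  have g: "g a \<in> {1..v}" "s (g a) = a" if "a \<in> V" for a
    using that assms(2) bij_betw_the_inv_into[OF assms(2)] f_the_inv_into_f_bij_betw[OF assms(2)]
    unfolding g_def by (auto dest: bij_betwE)
  have p: "p x = s k" if "k \<in> {1..v}" "x \<in> T k" for k x
  proof -
    have "(THE k. k \<in> {1..v} \<and> x \<in> T k) = k"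
      using that assms(4) by (intro the_equality) (auto dest: disjoint_family_onD)
    then show ?thesis by (simp add: p_def)
  qed
  have design: "row_column_design v e r c V S"
    using assms(1) by (simp add: sesqui_array_def)
  interpret blown_up_array m r c V "\<lambda>a. T (g a)" p S A
  proof
    show entry: "S i j \<in> V" if "i < r" "j < c" for i j
      using design that by (simp add: row_column_design_def)
    show "p x = a" if "a \<in> V" "x \<in> T (g a)" for a x
      using p[OF g(1)] g(2) that by simp
    show "bij_betw (\<lambda>t. A i (j * m + t)) {..<m} (T (g (S i j)))" if "i < r" "j < c" for i j
      using assms(6) that g[OF entry[OF that]] by (simp add: cellwise_replacement_def)
  qed (use assms(3,5) g(1) in auto)
  \<comment> \<open>Since \<open>g\<close> is onto the index set, the fibres \<open>T (g a)\<close>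
    exhaust the given symbol sets.\<close>
  have "g ` V = {1..v}"
    using bij_betw_the_inv_into[OF assms(2)] by (simp add: g_def bij_betw_def)
  then have "(\<Union>a\<in>V. T (g a)) = (\<Union>k\<in>{1..v}. T k)"
    by (metis image_image)
  then show ?thesis
    using sesqui_array_blow_up[OF assms(1)] not_CC_blow_up[OF design]
    by (auto simp: proper_sesqui_array_def)
qed

end
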